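(* Let $\underline{\mathcal{A}}=(\underline{a}_{ijkl})$ and $\overline{\mathcal{A}}=(\overline{a}_{ijkl})$ be symmetric real $4$th order $3$-dimensional tensors with $\underline{\mathcal{A}}\le\overline{\mathcal{A}}$, and let $\mathcal{A}^I=[\underline{\mathcal{A}},\overline{\mathcal{A}}]$. Suppose $\underline{a}_{1111}=\underline{a}_{2222}=0$ and $\underline{a}_{3333}=1$. Then $\mathcal{A}^I$ is positive semi-definite if $\underline{a}_{1112}=\underline{a}_{1113}=\underline{a}_{1222}=\underline{a}_{2223}=\underline{a}_{1333}=\overline{a}_{1112}=\overline{a}_{1113}=\overline{a}_{1222}=\overline{a}_{2223}=\overline{a}_{1333}=0$, $\underline{a}_{2333}=-1$, $\overline{a}_{2333}=1$, and one of the following conditions is satisfied: (a) $\underline{a}_{iijk}=\overline{a}_{iijk}=0$ for all pairwise distinct $i,j,k\in\{1,2,3\}$, $\underline{a}_{1122}\ge0$, $\underline{a}_{1133}\ge0$ and $\underline{a}_{2233}\ge\frac23$; (b) $\underline{a}_{1123}=-1$, $\overline{a}_{1123}=1$, $\underline{a}_{1223}=\underline{a}_{1233}=\overline{a}_{1223}=\overline{a}_{1233}=0$, $\underline{a}_{1122}\ge1$, $\underline{a}_{1133}\ge1$ and $\underline{a}_{2233}\ge\frac23$.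
   Context: A tensor $\mathcal{A}=(a_{ijkl})$, $i,j,k,l\in\{1,2,3\}$, is symmetric if its entries are invariant under all permutations of the indices (so a condition on one entry applies to all entries with permuted indices). Inequalities between tensors are entrywise, and $[\underline{\mathcal{A}},\overline{\mathcal{A}}]$ is the set of all real $4$th order $3$-dimensional tensors $\mathcal{A}$ with $\underline{\mathcal{A}}\le\mathcal{A}\le\overline{\mathcal{A}}$ (interval tensor). A tensor $\mathcal{A}$ is positive semi-definite if $\mathcal{A}x^4=\sum_{i,j,k,l=1}^3a_{ijkl}x_ix_jx_kx_l\ge0$ for all $x\in\mathbb{R}^3\setminus\{0\}$. An interval tensor is positive semi-definite if every tensor in it is. *)

theory Defs
  imports "HOL-Analysis.Analysis"
begin

text \<open>Fourth-order tensors of dimension \<open>CARD('n)\<close>; the entry with indices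
  \<open>i, j, k, l\<close> of \<open>A\<close> is \<open>A $ i $ j $ k $ l\<close>. In dimension three the index type is
  the numeral type \<open>3\<close>, whose elements are \<open>1, 2, 3\<close> (with \<open>3 = 0\<close> in that type).\<close>

type_synonym 'n tensor4 = "real ^ 'n ^ 'n ^ 'n ^ 'n"

definition symmetric_tensor :: "'n::finite tensor4 \<Rightarrow> bool" where
  "symmetric_tensor A \<longleftrightarrow>
     (\<forall>(\<iota> :: nat \<Rightarrow> 'n) \<sigma>. \<sigma> permutes {..<4} \<longrightarrow>
        A $ \<iota> (\<sigma> 0) $ \<iota> (\<sigma> 1) $ \<iota> (\<sigma> 2) $ \<iota> (\<sigma> 3) = A $ \<iota> 0 $ \<iota> 1 $ \<iota> 2 $ \<iota> 3)"

definition tensor_form :: "'n::finite tensor4 \<Rightarrow> real ^ 'n \<Rightarrow> real" where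
  "tensor_form A x =
     (\<Sum>i\<in>UNIV. \<Sum>j\<in>UNIV. \<Sum>k\<in>UNIV. \<Sum>l\<in>UNIV.
        A $ i $ j $ k $ l * x $ i * x $ j * x $ k * x $ l)"

definition psd_tensor :: "'n::finite tensor4 \<Rightarrow> bool" where
  "psd_tensor A \<longleftrightarrow> (\<forall>x. x \<noteq> 0 \<longrightarrow> 0 \<le> tensor_form A x)"

text \<open>The library order on vectors is componentwise, so on tensors it is the entrywise one.\<close>

lemma tensor4_le_iff:
  fixes A B :: "'n::finite tensor4"
  shows "A \<le> B \<longleftrightarrow> (\<forall>i j k l. A $ i $ j $ k $ l \<le> B $ i $ j $ k $ l)"
  by (simp add: less_eq_vec_def)

text \<open>The interval tensor with bounds \<open>L\<close> and \<open>U\<close> is the order interval \<open>{L..U}\<close>; it also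
  contains non-symmetric tensors, even if its bounds are symmetric.\<close>

definition psd_interval_tensor :: "'n::finite tensor4 set \<Rightarrow> bool" where
  "psd_interval_tensor I \<longleftrightarrow> (\<forall>A\<in>I. psd_tensor A)"

end

theory Submission
  imports Defs
begin

text \<open>For a fixed \<open>x\<close> the form is linear in the entries of the tensor, so over the interval
  \<open>{L..U}\<close> it is smallest at the vertex that takes the lower bound where the monomial
  \<open>x\<^sub>i x\<^sub>j x\<^sub>k x\<^sub>l\<close> is nonnegative and the upper bound elsewhere. The monomial does not depend on
  the order of the indices, so this vertex is a \<^emph>\<open>symmetric\<close> tensor when \<open>L\<close> and \<open>U\<close> are
  (\<open>symmetric_tensor_worst\<close>). Hence it suffices to test the symmetric members of the interval
  (\<open>psd_interval_tensor_symmetricI\<close>), even though the interval has non-symmetric ones as well.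

  The form of a symmetric tensor of dimension three is a ternary quartic with 15 coefficients
  (\<open>tensor_form_symmetric_3\<close>). Under the assumptions the coefficients of the non-square
  monomials vanish except those of \<open>x\<^sub>2 x\<^sub>3\<^sup>3\<close> and, in the second case, of \<open>x\<^sub>1\<^sup>2 x\<^sub>2 x\<^sub>3\<close>. With \<open>t\<close> and \<open>s\<close> the
  corresponding entries, both in \<open>[-1, 1]\<close>, what remains is bounded below by
  \<open>x\<^sub>3\<^sup>2 (x\<^sub>3\<^sup>2 + 4 t x\<^sub>2 x\<^sub>3 + 4 x\<^sub>2\<^sup>2) + 6 x\<^sub>1\<^sup>2 (x\<^sub>2\<^sup>2 + 2 s x\<^sub>2 x\<^sub>3 + x\<^sub>3\<^sup>2)\<close>, the second summand
  being absent in the first case. Both quadratic forms in brackets are nonnegative; the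
  constants \<open>2/3\<close> (that is, \<open>4 = 6 \<cdot> 2/3\<close>) and \<open>1\<close> are exactly where their discriminants vanish
  for \<open>t = \<plusminus>1\<close> and \<open>s = \<plusminus>1\<close>.\<close>

lemma symmetric_tensor_swap:
  fixes A :: "'n::finite tensor4"
  assumes "symmetric_tensor A"
  shows "A $ j $ i $ k $ l = A $ i $ j $ k $ l"
    and "A $ i $ k $ j $ l = A $ i $ j $ k $ l"
    and "A $ i $ j $ l $ k = A $ i $ j $ k $ l"
proof -
  have perm: "A $ [i,j,k,l] ! \<sigma> 0 $ [i,j,k,l] ! \<sigma> 1 $ [i,j,k,l] ! \<sigma> 2 $ [i,j,k,l] ! \<sigma> 3 = A $ i $ j $ k $ l"
    if "\<sigma> permutes {..<4}" for \<sigma> :: "nat \<Rightarrow> nat"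
    using assms[unfolded symmetric_tensor_def, rule_format, OF that, of "\<lambda>n. [i,j,k,l] ! n"]
    by (simp add: eval_nat_numeral)
  have swap: "Transposition.transpose a b permutes {..<4}" if "a < 4" "b < 4" for a b :: nat
    using that by (intro permutes_swap_id) auto
  show "A $ j $ i $ k $ l = A $ i $ j $ k $ l"
    using perm[OF swap[of 0 1]] by (simp add: transpose_def eval_nat_numeral)
  show "A $ i $ k $ j $ l = A $ i $ j $ k $ l"
    using perm[OF swap[of 1 2]] by (simp add: transpose_def eval_nat_numeral)
  show "A $ i $ j $ l $ k = A $ i $ j $ k $ l"
    using perm[OF swap[of 2 3]] by (simp add: transpose_def eval_nat_numeral)
qed

text \<open>The factors 4, 6 and 12 count the distinct rearrangements of the index word.\<close>

lemma tensor_form_symmetric_3: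
  fixes A :: "3 tensor4"
  assumes "symmetric_tensor A"
  shows "tensor_form A x =
      A$1$1$1$1 * x$1 ^ 4 + A$2$2$2$2 * x$2 ^ 4 + A$3$3$3$3 * x$3 ^ 4
    + 4 * (A$1$1$1$2 * (x$1 ^ 3 * x$2) + A$1$1$1$3 * (x$1 ^ 3 * x$3)
         + A$1$2$2$2 * (x$1 * x$2 ^ 3) + A$2$2$2$3 * (x$2 ^ 3 * x$3)
         + A$1$3$3$3 * (x$1 * x$3 ^ 3) + A$2$3$3$3 * (x$2 * x$3 ^ 3))
    + 6 * (A$1$1$2$2 * ((x$1)\<^sup>2 * (x$2)\<^sup>2) + A$1$1$3$3 * ((x$1)\<^sup>2 * (x$3)\<^sup>2)
         + A$2$2$3$3 * ((x$2)\<^sup>2 * (x$3)\<^sup>2))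
    + 12 * (A$1$1$2$3 * ((x$1)\<^sup>2 * x$2 * x$3) + A$1$2$2$3 * (x$1 * (x$2)\<^sup>2 * x$3)
          + A$1$2$3$3 * (x$1 * x$2 * (x$3)\<^sup>2))"
proof -
  note swap = symmetric_tensor_swap[OF assms]
  have sym:
    "A$1$1$2$1 = A$1$1$1$2" "A$1$2$1$1 = A$1$1$1$2" "A$2$1$1$1 = A$1$1$1$2"
    "A$1$1$3$1 = A$1$1$1$3" "A$1$3$1$1 = A$1$1$1$3" "A$3$1$1$1 = A$1$1$1$3"
    "A$2$1$2$2 = A$1$2$2$2" "A$2$2$1$2 = A$1$2$2$2" "A$2$2$2$1 = A$1$2$2$2"
    "A$2$2$3$2 = A$2$2$2$3" "A$2$3$2$2 = A$2$2$2$3" "A$3$2$2$2 = A$2$2$2$3"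
    "A$3$1$3$3 = A$1$3$3$3" "A$3$3$1$3 = A$1$3$3$3" "A$3$3$3$1 = A$1$3$3$3"
    "A$3$2$3$3 = A$2$3$3$3" "A$3$3$2$3 = A$2$3$3$3" "A$3$3$3$2 = A$2$3$3$3"
    "A$1$2$1$2 = A$1$1$2$2" "A$1$2$2$1 = A$1$1$2$2" "A$2$1$1$2 = A$1$1$2$2"
    "A$2$1$2$1 = A$1$1$2$2" "A$2$2$1$1 = A$1$1$2$2"
    "A$1$3$1$3 = A$1$1$3$3" "A$1$3$3$1 = A$1$1$3$3" "A$3$1$1$3 = A$1$1$3$3"
    "A$3$1$3$1 = A$1$1$3$3" "A$3$3$1$1 = A$1$1$3$3"
    "A$2$3$2$3 = A$2$2$3$3" "A$2$3$3$2 = A$2$2$3$3" "A$3$2$2$3 = A$2$2$3$3"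
    "A$3$2$3$2 = A$2$2$3$3" "A$3$3$2$2 = A$2$2$3$3"
    "A$1$1$3$2 = A$1$1$2$3" "A$1$2$1$3 = A$1$1$2$3" "A$1$2$3$1 = A$1$1$2$3"
    "A$1$3$1$2 = A$1$1$2$3" "A$1$3$2$1 = A$1$1$2$3" "A$2$1$1$3 = A$1$1$2$3"
    "A$2$1$3$1 = A$1$1$2$3" "A$2$3$1$1 = A$1$1$2$3" "A$3$1$1$2 = A$1$1$2$3"
    "A$3$1$2$1 = A$1$1$2$3" "A$3$2$1$1 = A$1$1$2$3"
    "A$1$2$3$2 = A$1$2$2$3" "A$1$3$2$2 = A$1$2$2$3" "A$2$1$2$3 = A$1$2$2$3"
    "A$2$1$3$2 = A$1$2$2$3" "A$2$2$1$3 = A$1$2$2$3" "A$2$2$3$1 = A$1$2$2$3"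
    "A$2$3$1$2 = A$1$2$2$3" "A$2$3$2$1 = A$1$2$2$3" "A$3$1$2$2 = A$1$2$2$3"
    "A$3$2$1$2 = A$1$2$2$3" "A$3$2$2$1 = A$1$2$2$3"
    "A$1$3$2$3 = A$1$2$3$3" "A$1$3$3$2 = A$1$2$3$3" "A$2$1$3$3 = A$1$2$3$3"
    "A$2$3$1$3 = A$1$2$3$3" "A$2$3$3$1 = A$1$2$3$3" "A$3$1$2$3 = A$1$2$3$3"
    "A$3$1$3$2 = A$1$2$3$3" "A$3$2$1$3 = A$1$2$3$3" "A$3$2$3$1 = A$1$2$3$3"
    "A$3$3$1$2 = A$1$2$3$3" "A$3$3$2$1 = A$1$2$3$3"
    by (simp_all add: swap)
  show ?thesis
    unfolding tensor_form_def sum_3 sym by algebra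
qed

definition worst_tensor :: "'n::finite tensor4 \<Rightarrow> 'n tensor4 \<Rightarrow> real ^ 'n \<Rightarrow> 'n tensor4" where
  "worst_tensor L U x = (\<chi> i j k l.
     if 0 \<le> x $ i * x $ j * x $ k * x $ l then L $ i $ j $ k $ l else U $ i $ j $ k $ l)"

lemma worst_tensor_mem: "L \<le> U \<Longrightarrow> worst_tensor L U x \<in> {L..U}"
  by (simp add: worst_tensor_def tensor4_le_iff)

lemma symmetric_tensor_worst:
  assumes "symmetric_tensor L" "symmetric_tensor U"
  shows "symmetric_tensor (worst_tensor L U x)"
  unfolding symmetric_tensor_def
proof (intro allI impI)
  fix \<iota> :: "nat \<Rightarrow> 'a" and \<sigma> :: "nat \<Rightarrow> nat"
  assume \<sigma>: "\<sigma> permutes {..<4}"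
  have set: "{..<4} = {0,1,2,3::nat}" by auto
  have "(\<Prod>n<4. x $ \<iota> (\<sigma> n)) = (\<Prod>n<4. x $ \<iota> n)"
    using prod.permute[OF \<sigma>, of "\<lambda>n. x $ \<iota> n"] by (simp add: o_def)
  then have "x $ \<iota> (\<sigma> 0) * x $ \<iota> (\<sigma> 1) * x $ \<iota> (\<sigma> 2) * x $ \<iota> (\<sigma> 3)
      = x $ \<iota> 0 * x $ \<iota> 1 * x $ \<iota> 2 * x $ \<iota> 3"
    by (simp add: set mult.assoc)
  moreover note assms[unfolded symmetric_tensor_def, rule_format, OF \<sigma>]
  ultimately show "worst_tensor L U x $ \<iota> (\<sigma> 0) $ \<iota> (\<sigma> 1) $ \<iota> (\<sigma> 2) $ \<iota> (\<sigma> 3)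
      = worst_tensor L U x $ \<iota> 0 $ \<iota> 1 $ \<iota> 2 $ \<iota> 3"
    by (simp add: worst_tensor_def)
qed

lemma tensor_form_worst_le:
  assumes "A \<in> {L..U}"
  shows "tensor_form (worst_tensor L U x) x \<le> tensor_form A x"
proof -
  have "worst_tensor L U x $ i $ j $ k $ l * x $ i * x $ j * x $ k * x $ l
      \<le> A $ i $ j $ k $ l * x $ i * x $ j * x $ k * x $ l" for i j k l
  proof -
    let ?m = "x $ i * x $ j * x $ k * x $ l"
    have "L $ i $ j $ k $ l \<le> A $ i $ j $ k $ l" "A $ i $ j $ k $ l \<le> U $ i $ j $ k $ l"
      using assms by (simp_all add: tensor4_le_iff)
    then have "worst_tensor L U x $ i $ j $ k $ l * ?m \<le> A $ i $ j $ k $ l * ?m"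
      by (simp add: worst_tensor_def mult_right_mono mult_right_mono_neg)
    then show ?thesis
      by (simp add: mult.assoc)
  qed
  then show ?thesis
    unfolding tensor_form_def by (intro sum_mono)
qed

text \<open>The worst tensor for \<open>x\<close> is itself a symmetric member of the interval, so a non-symmetric
  member has no smaller value there.\<close>

lemma psd_interval_tensor_symmetricI:
  assumes "symmetric_tensor L" "symmetric_tensor U" "L \<le> U"
    and "\<And>A. symmetric_tensor A \<Longrightarrow> A \<in> {L..U} \<Longrightarrow> psd_tensor A"
  shows "psd_interval_tensor {L..U}"
  unfolding psd_interval_tensor_def psd_tensor_def
proof (intro ballI allI impI)
  fix A x assume "A \<in> {L..U}" "x \<noteq> (0 :: real ^ 'a)"
  have "psd_tensor (worst_tensor L U x)"
    using assms by (intro assms(4) symmetric_tensor_worst worst_tensor_mem)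
  then have "0 \<le> tensor_form (worst_tensor L U x) x"
    using \<open>x \<noteq> 0\<close> by (simp add: psd_tensor_def)
  also have "\<dots> \<le> tensor_form A x"
    using \<open>A \<in> {L..U}\<close> by (rule tensor_form_worst_le)
  finally show "0 \<le> tensor_form A x" .
qed

lemma binary_quadratic_nonneg:
  fixes c t x y :: real
  assumes "\<bar>t\<bar> \<le> 1"
  shows "0 \<le> x\<^sup>2 + 2 * c * t * (x * y) + c\<^sup>2 * y\<^sup>2"
proof -
  have "t\<^sup>2 \<le> 1"
    using assms by (simp add: abs_square_le_1)
  then have "0 \<le> (x + c * t * y)\<^sup>2 + (1 - t\<^sup>2) * (c * y)\<^sup>2"
    by simp
  also have "\<dots> = x\<^sup>2 + 2 * c * t * (x * y) + c\<^sup>2 * y\<^sup>2"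
    by algebra
  finally show ?thesis .
qed

text \<open>The common shape of both cases: the two odd coefficients \<open>t\<close> and \<open>s\<close> are controlled by the
  even ones that enter the same quadratic form; the bound \<open>\<bar>s\<bar>\<close> on \<open>p\<close> and \<open>q\<close> covers
  \<open>s = 0\<close> with \<open>p, q \<ge> 0\<close> as well as \<open>\<bar>s\<bar> \<le> 1\<close> with \<open>p, q \<ge> 1\<close>.\<close>

lemma ternary_quartic_nonneg:
  fixes a b d p q r s t x y z :: real
  assumes "0 \<le> a" "0 \<le> b" "1 \<le> d" "\<bar>t\<bar> \<le> 1" "2/3 \<le> r" "\<bar>s\<bar> \<le> p" "\<bar>s\<bar> \<le> q"
  shows "0 \<le> a * x ^ 4 + b * y ^ 4 + d * z ^ 4 + 4 * (t * (y * z ^ 3))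
    + 6 * (p * (x\<^sup>2 * y\<^sup>2) + q * (x\<^sup>2 * z\<^sup>2) + r * (y\<^sup>2 * z\<^sup>2)) + 12 * (s * (x\<^sup>2 * y * z))"
proof -
  have "0 \<le> z\<^sup>2 * (z\<^sup>2 + 2 * 2 * t * (z * y) + 2\<^sup>2 * y\<^sup>2)"
    using assms by (intro mult_nonneg_nonneg binary_quadratic_nonneg) auto
  then have t: "0 \<le> z ^ 4 + 4 * (t * (y * z ^ 3)) + 4 * (y\<^sup>2 * z\<^sup>2)"
    by (simp add: algebra_simps power_numeral_reduce)
  (* Splitting s as its absolute value times its sign leaves a quadratic form in y and z whose
     middle coefficient does not depend on the size of s. *)
  have "0 \<le> \<bar>s\<bar> * (x\<^sup>2 * (y\<^sup>2 + 2 * 1 * sgn s * (y * z) + 1\<^sup>2 * z\<^sup>2))"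
    by (intro mult_nonneg_nonneg binary_quadratic_nonneg) (auto simp: abs_sgn_eq)
  also have "\<dots> = \<bar>s\<bar> * (x\<^sup>2 * y\<^sup>2) + \<bar>s\<bar> * (x\<^sup>2 * z\<^sup>2)
      + 2 * (\<bar>s\<bar> * sgn s * (x\<^sup>2 * y * z))"
    by (simp add: algebra_simps)
  also have "\<bar>s\<bar> * sgn s = s"
    by (simp add: abs_mult_sgn)
  finally have s: "0 \<le> \<bar>s\<bar> * (x\<^sup>2 * y\<^sup>2) + \<bar>s\<bar> * (x\<^sup>2 * z\<^sup>2) + 2 * (s * (x\<^sup>2 * y * z))" .
  have "0 \<le> a * x ^ 4" "0 \<le> b * y ^ 4" "1 * z ^ 4 \<le> d * z ^ 4"
    "\<bar>s\<bar> * (x\<^sup>2 * y\<^sup>2) \<le> p * (x\<^sup>2 * y\<^sup>2)" "\<bar>s\<bar> * (x\<^sup>2 * z\<^sup>2) \<le> q * (x\<^sup>2 * z\<^sup>2)"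
    "2/3 * (y\<^sup>2 * z\<^sup>2) \<le> r * (y\<^sup>2 * z\<^sup>2)"
    by (rule mult_nonneg_nonneg mult_right_mono; use assms in simp)+
  with s t show ?thesis
    by argo
qed

theorem theorem5p2:
  fixes L U :: "3 tensor4"
  assumes "symmetric_tensor L" and "symmetric_tensor U" and "L \<le> U"
    and "L $ 1 $ 1 $ 1 $ 1 = 0" and "L $ 2 $ 2 $ 2 $ 2 = 0" and "L $ 3 $ 3 $ 3 $ 3 = 1"
    and "L $ 1 $ 1 $ 1 $ 2 = 0" and "L $ 1 $ 1 $ 1 $ 3 = 0" and "L $ 1 $ 2 $ 2 $ 2 = 0"
    and "L $ 2 $ 2 $ 2 $ 3 = 0" and "L $ 1 $ 3 $ 3 $ 3 = 0"
    and "U $ 1 $ 1 $ 1 $ 2 = 0" and "U $ 1 $ 1 $ 1 $ 3 = 0" and "U $ 1 $ 2 $ 2 $ 2 = 0"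
    and "U $ 2 $ 2 $ 2 $ 3 = 0" and "U $ 1 $ 3 $ 3 $ 3 = 0"
    and "L $ 2 $ 3 $ 3 $ 3 = -1" and "U $ 2 $ 3 $ 3 $ 3 = 1"
    and "((\<forall>i j k. i \<noteq> j \<and> i \<noteq> k \<and> j \<noteq> k \<longrightarrow> L $ i $ i $ j $ k = 0 \<and> U $ i $ i $ j $ k = 0) \<and>
          L $ 1 $ 1 $ 2 $ 2 \<ge> 0 \<and> L $ 1 $ 1 $ 3 $ 3 \<ge> 0 \<and> L $ 2 $ 2 $ 3 $ 3 \<ge> 2/3)
       \<or> (L $ 1 $ 1 $ 2 $ 3 = -1 \<and> U $ 1 $ 1 $ 2 $ 3 = 1 \<and>
          L $ 1 $ 2 $ 2 $ 3 = 0 \<and> L $ 1 $ 2 $ 3 $ 3 = 0 \<and>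
          U $ 1 $ 2 $ 2 $ 3 = 0 \<and> U $ 1 $ 2 $ 3 $ 3 = 0 \<and>
          L $ 1 $ 1 $ 2 $ 2 \<ge> 1 \<and> L $ 1 $ 1 $ 3 $ 3 \<ge> 1 \<and> L $ 2 $ 2 $ 3 $ 3 \<ge> 2/3)"
  shows "psd_interval_tensor {L..U}"
proof (rule psd_interval_tensor_symmetricI)
  show "symmetric_tensor L" "symmetric_tensor U" "L \<le> U"
    by fact+
next
  fix A :: "3 tensor4"
  assume A: "symmetric_tensor A" and "A \<in> {L..U}"
  then have bounds: "L $ i $ j $ k $ l \<le> A $ i $ j $ k $ l" "A $ i $ j $ k $ l \<le> U $ i $ j $ k $ l"
    for i j k l
    by (simp_all add: tensor4_le_iff)
  then have pinned: "A $ i $ j $ k $ l = c"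
    if "L $ i $ j $ k $ l = c" "U $ i $ j $ k $ l = c" for i j k l c
    using that by (metis order_antisym)
  have mixed: "A$1$2$2$3 = 0 \<and> A$1$2$3$3 = 0 \<and> \<bar>A$1$1$2$3\<bar> \<le> A$1$1$2$2
      \<and> \<bar>A$1$1$2$3\<bar> \<le> A$1$1$3$3 \<and> 2/3 \<le> A$2$2$3$3"
    using assms(19)
  proof (elim disjE conjE, goal_cases)
    case 1
    (* The hypothesis speaks of the index words 2213 and 3312. *)
    have "A$1$2$2$3 = A$2$2$1$3" "A$1$2$3$3 = A$3$3$1$2"
      by (simp_all add: symmetric_tensor_swap[OF A])
    moreover have "A$2$2$1$3 = 0" "A$3$3$1$2 = 0" "A$1$1$2$3 = 0"
      using 1(1) by (auto intro!: pinned)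
    ultimately show ?case
      using 1 bounds(1)[of 1 1 2 2] bounds(1)[of 1 1 3 3] bounds(1)[of 2 2 3 3] by auto
  next
    case 2
    moreover have "\<bar>A$1$1$2$3\<bar> \<le> 1"
      using 2 bounds[of 1 1 2 3] by auto
    ultimately show ?case
      using bounds(1)[of 1 1 2 2] bounds(1)[of 1 1 3 3] bounds(1)[of 2 2 3 3]
      by (auto intro!: pinned)
  qed
  have odd: "A$1$1$1$2 = 0" "A$1$1$1$3 = 0" "A$1$2$2$2 = 0" "A$2$2$2$3 = 0" "A$1$3$3$3 = 0"
    using assms by (auto intro!: pinned)
  have "0 \<le> A$1$1$1$1" "0 \<le> A$2$2$2$2" "1 \<le> A$3$3$3$3" "\<bar>A$2$3$3$3\<bar> \<le> 1"
    using assms(4-6,17,18) bounds(1)[of 1 1 1 1] bounds(1)[of 2 2 2 2] bounds(1)[of 3 3 3 3]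
      bounds[of 2 3 3 3] by auto
  then have "0 \<le> tensor_form A x" for x
    using ternary_quartic_nonneg[of "A$1$1$1$1" "A$2$2$2$2" "A$3$3$3$3" "A$2$3$3$3"
        "A$2$2$3$3" "A$1$1$2$3" "A$1$1$2$2" "A$1$1$3$3" "x$1" "x$2" "x$3"] mixed
    by (simp add: tensor_form_symmetric_3[OF A] odd)
  then show "psd_tensor A"
    by (simp add: psd_tensor_def)
qed

end
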